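(* There exists a bounded microscopic set $X\subset\mathbb{R}$ which does not admit a cover of lower asymptotic density zero. That is, $X$ is microscopic, and there is $\varepsilon>0$ such that for no set $D\subset\omega$ with $\underline{d}(D)=0$ does there exist a sequence of intervals $(J_d)_{d\in D}$ with $X\subset\bigcup_{d\in D}J_d$ and $|J_d|\leq\varepsilon^{d+1}$ for all $d\in D$.
   Context: $\omega=\{0,1,2,\dots\}$ and each $n\in\omega$ is identified with $\{0,1,\dots,n-1\}$. For an interval $J$, $|J|$ denotes its length. A set $M\subset\mathbb{R}$ is microscopic if for each $\varepsilon>0$ there is a sequence of intervals $(J_n)_{n\in\omega}$ with $M\subset\bigcup_n J_n$ and $|J_n|\leq\varepsilon^{n+1}$ for each $n$. For $A\subset\omega$, the lower asymptotic density is $\underline{d}(A)=\liminf_{j\to\infty}\frac{\mathrm{card}(A\cap\{0,\dots,j\})}{j+1}$. A microscopic set $M$ admits a cover of lower asymptotic density $\delta$ if for every $\varepsilon>0$ there are $D\subset\omega$ with $\underline{d}(D)\leq\delta$ and intervals $(J_d)_{d\in D}$ covering $M$ with $|J_d|\leq\varepsilon^{d+1}$ for all $d\in D$. *)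

theory Defs
  imports "HOL-Analysis.Analysis"
begin

text \<open>Intervals may be open, closed, half-open, degenerate, empty or unbounded. Every interval is a
  Borel set, so its length in \<open>[0, \<infinity>]\<close> is its Lebesgue measure; in particular the bound in the
  following definitions excludes unbounded intervals.\<close>

definition microscopic :: "real set \<Rightarrow> bool" where
  "microscopic M \<longleftrightarrow>
    (\<forall>\<epsilon>::real. \<epsilon> > 0 \<longrightarrow>
      (\<exists>J :: nat \<Rightarrow> real set.
        (\<forall>n. is_interval (J n) \<and> emeasure lborel (J n) \<le> ennreal (\<epsilon> ^ (n + 1))) \<and>
        M \<subseteq> (\<Union>n. J n)))"

definition lower_density :: "nat set \<Rightarrow> ereal" where
  "lower_density A = liminf (\<lambda>j. ereal (real (card (A \<inter> {0..j})) / real (j + 1)))"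

text \<open>The values of \<open>J\<close> outside \<open>D\<close> are irrelevant.\<close>

definition admits_cover_of_lower_density :: "real set \<Rightarrow> real \<Rightarrow> bool" where
  "admits_cover_of_lower_density M \<delta> \<longleftrightarrow>
    (\<forall>\<epsilon>::real. \<epsilon> > 0 \<longrightarrow>
      (\<exists>(D :: nat set) (J :: nat \<Rightarrow> real set).
        lower_density D \<le> ereal \<delta> \<and>
        (\<forall>d\<in>D. is_interval (J d) \<and> emeasure lborel (J d) \<le> ennreal (\<epsilon> ^ (d + 1))) \<and>
        M \<subseteq> (\<Union>d\<in>D. J d)))"

lemma lower_density_nonneg: "0 \<le> lower_density A"
  unfolding lower_density_def by (intro Liminf_bounded always_eventually allI) simp

lemma lower_density_le_zero_iff: "lower_density A \<le> ereal 0 \<longleftrightarrow> lower_density A = 0"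
  using lower_density_nonneg[of A] by (auto simp: zero_ereal_def[symmetric] intro: antisym)

end

theory Submission
  imports Defs "HOL-Library.Discrete_Functions"
begin

text \<open>Around every dyadic grid point \<open>i / 2 ^ s\<close> put an interval of length
  \<open>(1/16) ^ (m * 2 ^ (s + 1))\<close>. Giving it the index \<open>2 ^ s + i\<close> shows that, for fixed \<open>m\<close>, these
  intervals satisfy the microscopic bound for \<open>\<epsilon> = (1/16) ^ m\<close>; the set \<open>X\<close> is the intersection over
  \<open>m \<ge> 1\<close> of their unions. Given a family of intervals for \<open>\<epsilon> = 1/16\<close>, indexed by a set \<open>D\<close> of lower
  density zero, nested grid intervals produce a point of \<open>X\<close> outside the family. Indeed, consider an
  interval of length \<open>L \<ge> (1/16) ^ N\<close> that avoids all members of index below \<open>N\<close>. The remaining members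
  have total length at most \<open>L / 8\<close>, so they meet at most \<open>2 ^ s * L / 8\<close> of the grid intervals of
  level \<open>s\<close>, up to an error of two per member, whereas about \<open>2 ^ s * L\<close> of them are available. Only
  the members of index below \<open>m * 2 ^ (s + 1)\<close> have to be avoided, and if \<open>D\<close> is sparse up to that
  index, then the error is small too.\<close>

section \<open>The set and its microscopic property\<close>

text \<open>Here \<open>Suc m\<close> is the \<open>m \<ge> 1\<close> of the overview, so
  \<open>m\<close> may range over all naturals. Halving makes the power of 1/16 the full length of
  the closed ball.\<close>

definition grid_radius :: "nat \<Rightarrow> nat \<Rightarrow> real" where
  "grid_radius m s = (1/16) ^ (Suc m * 2 ^ Suc s) / 2"

definition grid_interval :: "nat \<Rightarrow> nat \<Rightarrow> nat \<Rightarrow> real set" where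
  "grid_interval m s i = cball (real i / 2 ^ s) (grid_radius m s)"

definition grid_limsup :: "real set" where
  "grid_limsup = (\<Inter>m. \<Union>s. \<Union>i<2 ^ s. grid_interval m s i)"

lemma grid_radius_pos: "grid_radius m s > 0"
  by (simp add: grid_radius_def)

lemma grid_radius_le_half: "grid_radius m s \<le> 1/2"
  by (simp add: grid_radius_def power_le_one)

text \<open>The exponent is at least \<open>s\<close> and 1/16 is below 1/2. In counting arguments
  the width of a grid interval thus costs at most one mesh step.\<close>

lemma grid_radius_le_mesh: "2 * grid_radius m s * 2 ^ s \<le> 1"
proof -
  have "s \<le> Suc m * 2 ^ Suc s"
    using mult_le_mono[of 1 "Suc m" s "2 ^ Suc s"] less_exp[of "Suc s"] by linarith
  then have "(1/16::real) ^ (Suc m * 2 ^ Suc s) \<le> (1/16) ^ s"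
    by (intro power_decreasing) auto
  also have "\<dots> \<le> (1/2) ^ s"
    by (intro power_mono) auto
  finally show ?thesis
    by (simp add: grid_radius_def power_one_over field_simps)
qed

lemma bounded_grid_limsup: "bounded grid_limsup"
proof (rule boundedI)
  fix x assume "x \<in> grid_limsup"
  then obtain s i where i: "i < 2 ^ s" and "x \<in> grid_interval 0 s i"
    unfolding grid_limsup_def by blast
  then have "\<bar>x - real i / 2 ^ s\<bar> \<le> 1/2"
    using grid_radius_le_half[of 0 s] unfolding grid_interval_def mem_cball dist_real_def by linarith
  moreover have "real i < 2 ^ s"
    using i by (metis of_nat_less_iff of_nat_numeral of_nat_power)
  then have "real i / 2 ^ s \<le> 1" "0 \<le> real i / 2 ^ s"
    by simp_all
  ultimately show "norm x \<le> 2"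
    unfolding real_norm_def by linarith
qed

lemma microscopic_grid_limsup: "microscopic grid_limsup"
  unfolding microscopic_def
proof (intro allI impI)
  fix \<epsilon> :: real assume "\<epsilon> > 0"
  then obtain m where m: "(1/16) ^ m < \<epsilon>"
    using real_arch_pow_inv[of \<epsilon> "1/16"] by auto
  have m': "(1/16) ^ Suc m \<le> \<epsilon>"
    using m power_decreasing[of m "Suc m" "1/16::real"] by linarith
  \<comment> \<open>Every \<open>n > 0\<close> is uniquely \<open>2 ^ s + i\<close> with
    \<open>i < 2 ^ s\<close>, where \<open>s = floor_log n\<close>. Only index 0 is left
    over.\<close>
  define J where "J n = (if n = 0 then {} else
    grid_interval m (floor_log n) (n - 2 ^ floor_log n))" for n
  have len: "emeasure lborel (J n) \<le> ennreal (\<epsilon> ^ (n + 1))" for n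
  proof (cases "n = 0")
    case False
    \<comment> \<open>The bound demands exponent \<open>n + 1\<close>; the strict
      \<open>n < 2 ^ Suc (floor_log n)\<close> leaves room for exactly this extra 1.\<close>
    have "n + 1 \<le> 2 ^ Suc (floor_log n)"
      using floor_log_exp2_gt[of n] by simp
    then have "(1/16::real) ^ (Suc m * 2 ^ Suc (floor_log n)) \<le> (1/16) ^ (Suc m * (n + 1))"
      by (intro power_decreasing mult_le_mono2) auto
    also have "\<dots> = ((1/16) ^ Suc m) ^ (n + 1)"
      by (simp only: power_mult)
    also have "\<dots> \<le> \<epsilon> ^ (n + 1)"
      using m' by (intro power_mono) auto
    finally have "2 * grid_radius m (floor_log n) \<le> \<epsilon> ^ (n + 1)"
      by (simp add: grid_radius_def)
    moreover have "emeasure lborel (J n) = ennreal (2 * grid_radius m (floor_log n))"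
      using False grid_radius_pos[of m "floor_log n"]
      by (simp add: J_def grid_interval_def cball_eq_atLeastAtMost)
    ultimately show ?thesis
      by (simp add: ennreal_leI)
  qed (simp add: J_def)
  have "grid_limsup \<subseteq> (\<Union>n. J n)"
  proof
    fix x assume "x \<in> grid_limsup"
    then obtain s i where i: "i < 2 ^ s" and x: "x \<in> grid_interval m s i"
      unfolding grid_limsup_def by blast
    have "floor_log (2 ^ s + i) = s"
      using i by (intro floor_log_eqI) auto
    then have "x \<in> J (2 ^ s + i)"
      using x by (simp add: J_def)
    then show "x \<in> (\<Union>n. J n)" by blast
  qed
  moreover have "is_interval (J n)" for n
    by (simp add: J_def grid_interval_def is_interval_cball_1)
  ultimately show "\<exists>J. (\<forall>n. is_interval (J n) \<and> emeasure lborel (J n) \<le> ennreal (\<epsilon> ^ (n + 1))) \<and>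
      grid_limsup \<subseteq> (\<Union>n. J n)"
    using len by blast
qed

section \<open>Counting, length and density estimates\<close>

lemma card_le_of_dist_le:
  fixes A :: "nat set" and K :: real
  assumes "K \<ge> 0" and "\<And>i j. i \<in> A \<Longrightarrow> j \<in> A \<Longrightarrow> real j - real i \<le> K"
  shows "real (card A) \<le> K + 1"
proof (cases "A = {}")
  case False
  define l where "l = (LEAST i. i \<in> A)"
  have l: "l \<in> A" "\<And>i. i \<in> A \<Longrightarrow> l \<le> i"
    using False by (auto simp: l_def intro: LeastI Least_le)
  have "i \<le> l + nat \<lfloor>K\<rfloor>" if "i \<in> A" for i
    using assms(2)[OF l(1) that] by linarith
  then have "A \<subseteq> {l..l + nat \<lfloor>K\<rfloor>}"
    using l(2) by auto
  then have "card A \<le> card {l..l + nat \<lfloor>K\<rfloor>}"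
    by (intro card_mono) auto
  then have "real (card A) \<le> real (nat \<lfloor>K\<rfloor>) + 1"
    by simp
  then show ?thesis
    using assms(1) by linarith
qed (use assms in simp)

text \<open>Rounding \<open>x\<close> up and \<open>y\<close> down loses less than 1 each, and
  counting both endpoints regains 1.\<close>

lemma card_nat_interval_ge:
  fixes x y :: real
  assumes "0 \<le> x" "x \<le> y"
  shows "y - x - 1 \<le> real (card {i::nat. x \<le> real i \<and> real i \<le> y})"
proof -
  have "{nat \<lceil>x\<rceil>..nat \<lfloor>y\<rfloor>} \<subseteq> {i::nat. x \<le> real i \<and> real i \<le> y}"
    using assms by (auto simp: nat_le_iff le_nat_iff le_floor_iff ceiling_le_iff)
  moreover have "finite {i::nat. x \<le> real i \<and> real i \<le> y}"
    by (rule finite_subset[of _ "{..nat \<lfloor>y\<rfloor>}"]) (use assms in \<open>auto simp: le_nat_iff le_floor_iff\<close>)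
  ultimately have "card {nat \<lceil>x\<rceil>..nat \<lfloor>y\<rfloor>} \<le> card {i::nat. x \<le> real i \<and> real i \<le> y}"
    by (intro card_mono)
  moreover have "y - x - 1 \<le> real (card {nat \<lceil>x\<rceil>..nat \<lfloor>y\<rfloor>})"
    using assms by simp linarith
  ultimately show ?thesis
    by linarith
qed

text \<open>Turns the measure bound of the definitions into a diameter bound: an interval contains
  the segment between any two of its points.\<close>

lemma interval_diff_le:
  fixes S :: "real set"
  assumes "is_interval S" "emeasure lborel S \<le> ennreal K" "K \<ge> 0" "x \<in> S" "y \<in> S"
  shows "y - x \<le> K"
proof (cases "x \<le> y")
  case True
  have "{x..y} \<subseteq> S"
    using assms unfolding is_interval_1 by (meson atLeastAtMost_iff subsetI)
  moreover have "S \<in> sets lborel"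
    using real_interval_borel_measurable[OF assms(1)] by simp
  ultimately have "emeasure lborel {x..y} \<le> emeasure lborel S"
    by (rule emeasure_mono)
  then have "emeasure lborel {x..y} \<le> ennreal K"
    using assms(2) by (rule order_trans)
  then show ?thesis
    using True assms(3) by simp
qed (use assms in auto)

text \<open>A ratio above \<open>\<eta>\<close> from \<open>j0\<close> on would force the lower
  density up to \<open>\<eta>\<close>. The free \<open>j0\<close> provides sparse initial segments
  of arbitrarily large length.\<close>

lemma lower_density_zeroD:
  assumes "lower_density D \<le> ereal 0" "\<eta> > 0"
  shows "\<exists>j\<ge>j0. real (card (D \<inter> {0..j})) \<le> \<eta> * real (j + 1)"
proof (rule ccontr)
  assume "\<not> ?thesis"
  then have "\<eta> * real (j + 1) \<le> real (card (D \<inter> {0..j}))" if "j \<ge> j0" for j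
    using that by (meson le_cases)
  then have "ereal \<eta> \<le> ereal (real (card (D \<inter> {0..j})) / real (j + 1))" if "j \<ge> j0" for j
    using that by (simp add: pos_le_divide_eq del: of_nat_Suc of_nat_add)
  then have "ereal \<eta> \<le> lower_density D"
    unfolding lower_density_def
    by (intro Liminf_bounded) (auto simp: eventually_sequentially)
  with assms(1) have "ereal \<eta> \<le> ereal 0"
    by (rule order_trans[rotated])
  with assms(2) show False
    by simp
qed

text \<open>The \<open>j\<close> at which \<open>D\<close> is sparse cannot be prescribed, but the
  construction needs an index \<open>M * 2 ^ s\<close>. Rounding \<open>j div M\<close> down to a
  power of two loses less than a factor 2.\<close>

lemma dyadic_scale:
  fixes M j :: nat
  assumes "0 < M" "M * 2 ^ t \<le> j"
  shows "\<exists>s\<ge>t. M * 2 ^ s \<le> j \<and> j < 2 * (M * 2 ^ s)"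
proof -
  have "2 ^ t \<le> j div M"
    using assms by (simp add: less_eq_div_iff_mult_less_eq mult.commute)
  then have nz: "j div M \<noteq> 0"
    by (metis le_zero_eq power_not_zero zero_neq_numeral)
  define s where "s = floor_log (j div M)"
  have "2 ^ s \<le> j div M" "j div M < 2 * 2 ^ s"
    using floor_log_exp2_le[of "j div M"] floor_log_exp2_gt[of "j div M"] nz by (auto simp: s_def)
  moreover have "t \<le> s"
    using floor_log_le_iff[OF \<open>2 ^ t \<le> j div M\<close>] by (simp add: s_def)
  ultimately show ?thesis
    using assms(1) by (intro exI[of _ s])
      (simp add: less_eq_div_iff_mult_less_eq div_less_iff_less_mult mult.commute mult.left_commute)
qed

lemma sum_powers_le:
  fixes F :: "nat set"
  assumes "finite F" "\<And>d. d \<in> F \<Longrightarrow> N \<le> d"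
  shows "(\<Sum>d\<in>F. (1/16::real) ^ (d + 1)) \<le> (1/16) ^ N / 8"
proof -
  \<comment> \<open>The full tail is \<open>(1/16) ^ N / 15\<close>; the subtracted term makes the
    cruder bound with 8 inductive.\<close>
  have tail: "(\<Sum>d=N..<N+k. (1/16::real) ^ (d + 1)) \<le> (1/16) ^ N / 8 - (1/16) ^ (N + k) / 8" for k
  proof (induction k)
    case (Suc k)
    define p :: real where "p = (1/16) ^ (N + k)"
    have "0 \<le> p" by (simp add: p_def)
    moreover have "(1/16::real) ^ (N + Suc k) = p / 16" "(1/16::real) ^ (N + k + 1) = p / 16"
      by (simp_all add: p_def)
    ultimately show ?case
      using Suc by (simp add: p_def[symmetric])
  qed simp
  obtain K where "F \<subseteq> {..<K}"
    using assms(1) finite_nat_iff_bounded by blast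
  then have "F \<subseteq> {N..<N+K}"
    using assms(2) by fastforce
  then have "(\<Sum>d\<in>F. (1/16::real) ^ (d + 1)) \<le> (\<Sum>d=N..<N+K. (1/16) ^ (d + 1))"
    by (intro sum_mono2) auto
  also have "\<dots> \<le> (1/16) ^ N / 8"
    using tail[of K] by (smt (verit) zero_le_power divide_nonneg_nonneg)
  finally show ?thesis .
qed

section \<open>Grid intervals met by or contained in an interval\<close>

text \<open>Centres of two grid intervals that are met differ by at most \<open>K\<close> plus one
  mesh step. Passing from index distance to cardinality adds another 1, hence the error of two per
  member.\<close>

lemma card_grid_intervals_meeting_le:
  assumes "is_interval S" "emeasure lborel S \<le> ennreal K" "K \<ge> 0"
  shows "real (card {i. i < 2 ^ s \<and> grid_interval m s i \<inter> S \<noteq> {}}) \<le> 2 ^ s * K + 2"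
proof -
  have "real j - real i \<le> 2 ^ s * K + 1"
    if meet: "grid_interval m s i \<inter> S \<noteq> {}" "grid_interval m s j \<inter> S \<noteq> {}" for i j
  proof -
    obtain x y where x: "x \<in> S" "x \<in> grid_interval m s i" and y: "y \<in> S" "y \<in> grid_interval m s j"
      using meet by blast
    have "y - x \<le> K"
      using interval_diff_le[OF assms x(1) y(1)] .
    then have "real j / 2 ^ s - real i / 2 ^ s \<le> K + 2 * grid_radius m s"
      using x(2) y(2) unfolding grid_interval_def mem_cball dist_real_def by linarith
    then have "2 ^ s * (real j / 2 ^ s - real i / 2 ^ s) \<le> 2 ^ s * (K + 2 * grid_radius m s)"
      by (intro mult_left_mono) auto
    then show ?thesis
      using grid_radius_le_mesh[of m s] by (simp add: algebra_simps)
  qed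
  then have "real (card {i. i < 2 ^ s \<and> grid_interval m s i \<inter> S \<noteq> {}}) \<le> (2 ^ s * K + 1) + 1"
    using assms(3) by (intro card_le_of_dist_le) auto
  then show ?thesis by simp
qed

text \<open>It suffices that the centre lies in \<open>[a + \<rho>, b - \<rho>]\<close>. Shrinking
  and rounding cost at most 1 each, which by \<open>big\<close> is at most half of the main
  term.\<close>

lemma card_grid_intervals_inside_ge:
  assumes "0 \<le> a" "b \<le> 1" and big: "4 \<le> 2 ^ s * (b - a)"
  shows "2 ^ s * (b - a) / 2 \<le> real (card {i. i < 2 ^ s \<and> grid_interval m s i \<subseteq> {a..b}})"
proof -
  define \<rho> where "\<rho> = grid_radius m s"
  have \<rho>: "0 < \<rho>" "2 * \<rho> * 2 ^ s \<le> 1"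
    using grid_radius_pos grid_radius_le_mesh by (auto simp: \<rho>_def)
  define x y where "x = 2 ^ s * (a + \<rho>)" and "y = 2 ^ s * (b - \<rho>)"
  have yx: "y - x \<ge> 2 ^ s * (b - a) - 1"
    using \<rho>(2) by (simp add: x_def y_def algebra_simps)
  have "y - x - 1 \<le> real (card {i::nat. x \<le> real i \<and> real i \<le> y})"
    using assms \<rho> yx big by (intro card_nat_interval_ge) (auto simp: x_def)
  also have "\<dots> \<le> real (card {i. i < 2 ^ s \<and> grid_interval m s i \<subseteq> {a..b}})"
  proof -
    have "i < 2 ^ s \<and> grid_interval m s i \<subseteq> {a..b}" if "x \<le> real i" "real i \<le> y" for i
    proof -
      have 1: "a + \<rho> \<le> real i / 2 ^ s" "real i / 2 ^ s \<le> b - \<rho>"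
        using that by (simp_all add: x_def y_def field_simps)
      \<comment> \<open>Strictness comes from \<open>\<rho> > 0\<close> and excludes the grid point
        1, that is \<open>i = 2 ^ s\<close>.\<close>
      then have "real i / 2 ^ s < 1"
        using assms \<rho>(1) by linarith
      then have "real i < 2 ^ s"
        by simp
      then have "i < 2 ^ s"
        by (metis of_nat_less_iff of_nat_numeral of_nat_power)
      with 1 show ?thesis
        by (auto simp: grid_interval_def \<rho>_def cball_eq_atLeastAtMost)
    qed
    then show ?thesis
      by (intro of_nat_mono card_mono) auto
  qed
  finally show ?thesis
    using yx big by linarith
qed

section \<open>The nested construction\<close>

text \<open>One step of the nesting: the new interval has length \<open>(1/16) ^ N'\<close> and
  avoids the members of index below \<open>N'\<close>, for \<open>N' = Suc m * 2 ^ Suc s\<close>, so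
  the step can be repeated.\<close>

lemma avoiding_grid_interval:
  assumes D: "lower_density D \<le> ereal 0"
    and J: "\<And>d. d \<in> D \<Longrightarrow> is_interval (J d)"
      "\<And>d. d \<in> D \<Longrightarrow> emeasure lborel (J d) \<le> ennreal ((1/16) ^ (d + 1))"
    and ab: "0 \<le> a" "a < b" "b \<le> 1" "(1/16) ^ N \<le> b - a"
    and avoid: "\<And>d. d \<in> D \<Longrightarrow> d < N \<Longrightarrow> {a..b} \<inter> J d = {}"
  shows "\<exists>s i. i < 2 ^ s \<and> grid_interval m s i \<subseteq> {a..b} \<and>
    (\<forall>d\<in>D. d < Suc m * 2 ^ Suc s \<longrightarrow> grid_interval m s i \<inter> J d = {})"
proof -
  define L where "L = b - a"
  have L: "0 < L" using ab by (simp add: L_def)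
  obtain t where t: "4 / L < 2 ^ t"
    using real_arch_pow[of 2 "4 / L"] by auto
  define M where "M = Suc m * 2"
  \<comment> \<open>With \<open>j + 1 < 2 * (M * 2 ^ s)\<close> this yields
    \<open>card F \<le> 2 ^ s * L / 16\<close>; the error of two per member then totals at most
    \<open>2 ^ s * L / 8\<close>.\<close>
  define \<eta> where "\<eta> = L / (32 * real M)"
  have "\<eta> > 0"
    using L by (simp add: \<eta>_def M_def)
  then obtain j where j: "j \<ge> M * 2 ^ t" "real (card (D \<inter> {0..j})) \<le> \<eta> * real (j + 1)"
    using lower_density_zeroD[OF D] by blast
  \<comment> \<open>Rounding \<open>j + 1\<close> rather than \<open>j\<close> suffices, since
    indices below \<open>M * 2 ^ s\<close> are then still at most \<open>j\<close>.\<close>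
  have "\<exists>s\<ge>t. M * 2 ^ s \<le> j + 1 \<and> j + 1 < 2 * (M * 2 ^ s)"
    using j(1) by (intro dyadic_scale) (auto simp: M_def)
  then obtain s where s: "s \<ge> t" "M * 2 ^ s \<le> j + 1" "j + 1 < 2 * (M * 2 ^ s)"
    by blast
  define G where "G = {i. i < 2 ^ s \<and> grid_interval m s i \<subseteq> {a..b}}"
  define B where "B d = {i. i < 2 ^ s \<and> grid_interval m s i \<inter> J d \<noteq> {}}" for d
  \<comment> \<open>Members below \<open>N\<close> already miss \<open>{a..b}\<close>; those from
    \<open>M * 2 ^ s = Suc m * 2 ^ Suc s\<close> on are left to later steps.\<close>
  define F where "F = {d \<in> D. N \<le> d \<and> d < M * 2 ^ s}"
  have "finite F"
    by (rule finite_subset[of _ "{..<M * 2 ^ s}"]) (auto simp: F_def)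
  have "4 \<le> 2 ^ t * L"
    using t L by (simp add: field_simps)
  also have "\<dots> \<le> 2 ^ s * L"
    using s(1) L by (intro mult_right_mono power_increasing) auto
  finally have big: "4 \<le> 2 ^ s * L" .
  have G: "2 ^ s * L / 2 \<le> real (card G)"
    unfolding G_def L_def using ab big by (intro card_grid_intervals_inside_ge) (auto simp: L_def)
  have "card F \<le> card (D \<inter> {0..j})"
    using s(2) by (intro card_mono) (auto simp: F_def)
  then have "real (card F) \<le> \<eta> * real (j + 1)"
    using j(2) by linarith
  also have "\<dots> \<le> \<eta> * real (2 * (M * 2 ^ s))"
    using s(3) \<open>\<eta> > 0\<close> by (intro mult_left_mono of_nat_mono) auto
  also have "\<dots> = 2 ^ s * L / 16"
    by (simp add: \<eta>_def M_def field_simps)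
  finally have cF: "real (card F) \<le> 2 ^ s * L / 16" .
  have "real (card (\<Union>d\<in>F. B d)) \<le> (\<Sum>d\<in>F. real (card (B d)))"
    using card_UN_le[OF \<open>finite F\<close>, of B] by (metis of_nat_le_iff of_nat_sum)
  also have "\<dots> \<le> (\<Sum>d\<in>F. 2 ^ s * (1/16) ^ (d + 1) + 2)"
    unfolding B_def by (intro sum_mono card_grid_intervals_meeting_le J) (auto simp: F_def)
  also have "\<dots> = 2 ^ s * (\<Sum>d\<in>F. (1/16) ^ (d + 1)) + 2 * real (card F)"
    by (simp add: sum.distrib sum_distrib_left)
  also have "\<dots> \<le> 2 ^ s * (L / 8) + 2 * (2 ^ s * L / 16)"
  proof (intro add_mono mult_left_mono cF)
    have "(\<Sum>d\<in>F. (1/16) ^ (d + 1)) \<le> (1/16::real) ^ N / 8"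
      using \<open>finite F\<close> by (rule sum_powers_le) (simp add: F_def)
    also have "\<dots> \<le> L / 8"
      unfolding L_def using ab(4) by (rule divide_right_mono) simp
    finally show "(\<Sum>d\<in>F. (1/16) ^ (d + 1)) \<le> L / 8" .
  qed auto
  \<comment> \<open>The two eighths, from total length and from counting errors, leave half of the
    lower bound for \<open>G\<close> to spare.\<close>
  also have "\<dots> < 2 ^ s * L / 2"
    using L by simp
  finally have "card (\<Union>d\<in>F. B d) < card G"
    using G by linarith
  moreover have "finite (\<Union>d\<in>F. B d)"
    using \<open>finite F\<close> by (auto simp: B_def)
  ultimately have "\<not> G \<subseteq> (\<Union>d\<in>F. B d)"
    by (meson card_mono not_le)
  then obtain i where i: "i \<in> G" "i \<notin> (\<Union>d\<in>F. B d)"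
    by blast
  have "grid_interval m s i \<inter> J d = {}" if "d \<in> D" "d < Suc m * 2 ^ Suc s" for d
  proof (cases "d < N")
    case True
    then show ?thesis using avoid[OF that(1)] i(1) by (auto simp: G_def)
  next
    case False
    then have "d \<in> F"
      using that by (simp add: F_def M_def algebra_simps)
    then show ?thesis
      using i by (auto simp: G_def B_def)
  qed
  then show ?thesis
    using i(1) by (auto simp: G_def)
qed

lemma not_grid_limsup_cover:
  assumes D: "lower_density D \<le> ereal 0"
    and J: "\<And>d. d \<in> D \<Longrightarrow> is_interval (J d)"
      "\<And>d. d \<in> D \<Longrightarrow> emeasure lborel (J d) \<le> ennreal ((1/16) ^ (d + 1))"
  shows "\<not> grid_limsup \<subseteq> (\<Union>d\<in>D. J d)"
proof -
  \<comment> \<open>\<open>N\<close> bounds the length from below and marks the indices already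
    avoided; \<open>k \<le> N\<close> ensures that every index is treated eventually.\<close>
  define P where "P k = (\<lambda>(a::real, b, N::nat). 0 \<le> a \<and> a < b \<and> b \<le> 1 \<and> (1/16) ^ N \<le> b - a \<and> k \<le> N \<and>
    (\<forall>d\<in>D. d < N \<longrightarrow> {a..b} \<inter> J d = {}))" for k
  define Q where "Q m = (\<lambda>(a::real, b, N::nat) (a', b', N'::nat). {a'..b'} \<subseteq> {a..b} \<and>
    (\<exists>s. \<exists>i<2 ^ s. {a'..b'} = grid_interval m s i))" for m
  have "\<exists>f. \<forall>n. P n (f n) \<and> Q n (f n) (f (Suc n))"
  proof (rule dependent_nat_choice)
    show "\<exists>x. P 0 x"
      \<comment> \<open>The unit interval has length \<open>(1/16) ^ 0\<close>, and no index lies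
        below 0.\<close>
      by (rule exI[of _ "(0, 1, 0)"]) (simp add: P_def)
  next
    fix x m assume "P m x"
    then obtain a b N where x: "x = (a, b, N)" and ab: "0 \<le> a" "a < b" "b \<le> 1" "(1/16) ^ N \<le> b - a"
      and avoid: "\<And>d. d \<in> D \<Longrightarrow> d < N \<Longrightarrow> {a..b} \<inter> J d = {}"
      by (cases x) (auto simp: P_def)
    obtain s i where i: "i < 2 ^ s" and sub: "grid_interval m s i \<subseteq> {a..b}"
      and avoid': "\<forall>d\<in>D. d < Suc m * 2 ^ Suc s \<longrightarrow> grid_interval m s i \<inter> J d = {}"
      using avoiding_grid_interval[OF D J ab avoid] by blast
    define a' b' where "a' = real i / 2 ^ s - grid_radius m s" and "b' = real i / 2 ^ s + grid_radius m s"
    have eq: "{a'..b'} = grid_interval m s i"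
      by (simp add: grid_interval_def a'_def b'_def cball_eq_atLeastAtMost)
    have "a' < b'"
      using grid_radius_pos[of m s] by (simp add: a'_def b'_def)
    moreover have "{a'..b'} \<subseteq> {a..b}"
      using sub by (simp only: eq)
    ultimately have "0 \<le> a'" "b' \<le> 1"
      using ab by auto
    moreover have "(1/16) ^ (Suc m * 2 ^ Suc s) \<le> b' - a'"
      by (simp add: a'_def b'_def grid_radius_def)
    moreover have "Suc m \<le> Suc m * 2 ^ Suc s"
      using mult_le_mono2[of 1 "2 ^ Suc s" "Suc m"] by simp
    ultimately have "P (Suc m) (a', b', Suc m * 2 ^ Suc s)"
      using \<open>a' < b'\<close> avoid' unfolding P_def prod.case eq by blast
    moreover have "Q m x (a', b', Suc m * 2 ^ Suc s)"
      unfolding Q_def x prod.case eq using sub i by blast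
    ultimately show "\<exists>y. P (Suc m) y \<and> Q m x y"
      by blast
  qed
  then obtain f where f: "\<And>n. P n (f n)" "\<And>n. Q n (f n) (f (Suc n))"
    by blast
  define I where "I n = (case f n of (a, b, N) \<Rightarrow> {a..b})" for n
  have I: "compact (I n)" "I n \<noteq> {}" "\<forall>d\<in>D. d < n \<longrightarrow> I n \<inter> J d = {}" for n
    using f(1)[of n] unfolding I_def P_def by (auto split: prod.splits)
  have I': "I (Suc n) \<subseteq> I n" "\<exists>s. \<exists>i<2 ^ s. I (Suc n) = grid_interval n s i" for n
    using f(2)[of n] unfolding I_def Q_def by (auto split: prod.splits)
  have "\<Inter>(range I) \<noteq> {}"
    using I(1,2) lift_Suc_antimono_le[of I, OF I'(1)] by (rule compact_nest)
  then obtain x where x: "\<And>n. x \<in> I n"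
    by blast
  \<comment> \<open>Stage \<open>Suc m\<close> is itself a grid interval for \<open>m\<close>, so
    the common point lies in every union that defines \<open>grid_limsup\<close>.\<close>
  have "\<exists>s. \<exists>i<2 ^ s. x \<in> grid_interval m s i" for m
    using x[of "Suc m"] I'(2)[of m] by metis
  then have "x \<in> grid_limsup"
    by (simp add: grid_limsup_def Bex_def)
  moreover have "x \<notin> J d" if "d \<in> D" for d
    using I(3)[of "Suc d"] x[of "Suc d"] that by blast
  ultimately show ?thesis
    by blast
qed

theorem theorem3p1:
  shows "\<exists>X :: real set.
    bounded X \<and> microscopic X \<and> \<not> admits_cover_of_lower_density X 0"
proof (intro exI conjI)
  show "\<not> admits_cover_of_lower_density grid_limsup 0"
  proof
    assume "admits_cover_of_lower_density grid_limsup 0"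
    \<comment> \<open>The failing value is \<open>\<epsilon> = 1/16\<close>, the base of the grid
      lengths.\<close>
    then obtain D :: "nat set" and J where "lower_density D \<le> ereal 0"
      "\<forall>d\<in>D. is_interval (J d) \<and> emeasure lborel (J d) \<le> ennreal ((1/16) ^ (d + 1))"
      "grid_limsup \<subseteq> (\<Union>d\<in>D. J d)"
      unfolding admits_cover_of_lower_density_def
      by (metis zero_less_divide_1_iff zero_less_numeral)
    then show False
      using not_grid_limsup_cover by blast
  qed
qed (fact bounded_grid_limsup microscopic_grid_limsup)+

end
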